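(* Let $E$ be a complex Hilbert space and let $f\in\mathcal{B}(B_E)$. The function $x\mapsto(1-\|x\|^2)|\mathcal{R}f(x)|$, $x\in B_E$, is Lipschitz with respect to the pseudohyperbolic distance, and for all $x,y\in B_E$ $$\Bigl|(1-\|x\|^2)\,|\mathcal{R}f(x)|-(1-\|y\|^2)\,|\mathcal{R}f(y)|\Bigr|\le 14\,\|f\|_{\mathcal{I}}\;\rho_E(x,y).$$
   Context: $E$ is a finite or infinite dimensional complex Hilbert space (inner product linear in the first variable), $B_E$ its open unit ball. The pseudohyperbolic distance $\rho_E(x,y)\in[0,1)$ on $B_E$ is given by $\rho_E(x,y)^2=1-\frac{(1-\|x\|^2)(1-\|y\|^2)}{|1-\langle x,y\rangle|^2}$. For holomorphic (Fréchet differentiable) $f:B_E\to\mathbb{C}$, $\nabla f(x)$ denotes the derivative $f'(x)$, and $\mathcal{R}f(x)=\langle x,\overline{\nabla f(x)}\rangle=f'(x)(x)$ is the radial derivative. The Bloch space $\mathcal{B}(B_E)$ is the set of holomorphic $f:B_E\to\mathbb{C}$ with $\sup_{x\in B_E}(1-\|x\|^2)\|\nabla f(x)\|<\infty$. For $x\in B_E$, let $\varphi_x:B_E\to B_E$ be the automorphism $\varphi_x(y)=(s_xQ_x+P_x)\left(\frac{x-y}{1-\langle y,x\rangle}\right)$, where $s_x=\sqrt{1-\|x\|^2}$, $P_x(y)=\frac{\langle y,x\rangle}{\langle x,x\rangle}x$ is the orthogonal projection onto the span of $x$, $Q_x=\mathrm{Id}_E-P_x$, and $P_0=0$ (so $\varphi_0(y)=-y$).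 The invariant gradient is $\widetilde\nabla f(x)=\nabla(f\circ\varphi_x)(0)$ and $\|f\|_{\mathcal{I}}=\sup_{x\in B_E}\|\widetilde\nabla f(x)\|$, which is finite for $f\in\mathcal{B}(B_E)$. *)

theory Defs
  imports "HOL-Analysis.Analysis"
begin

section \<open>Complex Hilbert spaces\<close>

text \<open>The inner product is linear in its first argument. The real scalar
  multiplication and the norm inherited from \<^class>\<open>real_normed_vector\<close> are tied to
  the complex structure by the first and the last axiom.\<close>

class complex_inner = real_normed_vector +
  fixes scaleC :: "complex \<Rightarrow> 'a \<Rightarrow> 'a"  (infixr "*\<^sub>C" 75)
    and cinner :: "'a \<Rightarrow> 'a \<Rightarrow> complex"
  assumes scaleR_eq_scaleC: "scaleR r x = complex_of_real r *\<^sub>C x"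
    and scaleC_add_right: "c *\<^sub>C (x + y) = c *\<^sub>C x + c *\<^sub>C y"
    and scaleC_add_left: "(c + d) *\<^sub>C x = c *\<^sub>C x + d *\<^sub>C x"
    and scaleC_scaleC: "c *\<^sub>C d *\<^sub>C x = (c * d) *\<^sub>C x"
    and scaleC_one: "1 *\<^sub>C x = x"
    and cinner_commute: "cinner x y = cnj (cinner y x)"
    and cinner_add_left: "cinner (x + y) z = cinner x z + cinner y z"
    and cinner_scaleC_left: "cinner (c *\<^sub>C x) y = c * cinner x y"
    and cinner_ge_zero: "0 \<le> Re (cinner x x)"
    and cinner_eq_zero_iff: "cinner x x = 0 \<longleftrightarrow> x = 0"
    and norm_eq_sqrt_cinner: "norm x = sqrt (Re (cinner x x))"

class complex_hilbert = complex_inner + complete_space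

instantiation complex :: complex_hilbert
begin

definition scaleC_complex :: "complex \<Rightarrow> complex \<Rightarrow> complex"
  where "scaleC_complex c x = c * x"

definition cinner_complex :: "complex \<Rightarrow> complex \<Rightarrow> complex"
  where "cinner_complex x y = x * cnj y"

instance
  by standard
    (auto simp: scaleC_complex_def cinner_complex_def scaleR_conv_of_real algebra_simps
      cmod_def power2_eq_square)

end

section \<open>Pseudohyperbolic distance and automorphisms of the unit ball\<close>

definition pseudohyp_dist :: "'a::complex_hilbert \<Rightarrow> 'a \<Rightarrow> real"
  where "pseudohyp_dist x y =
    sqrt (1 - (1 - (norm x)\<^sup>2) * (1 - (norm y)\<^sup>2) / (cmod (1 - cinner x y))\<^sup>2)"

definition proj_span :: "'a::complex_hilbert \<Rightarrow> 'a \<Rightarrow> 'a"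
  where "proj_span x y = (if x = 0 then 0 else (cinner y x / cinner x x) *\<^sub>C x)"

definition ball_aut :: "'a::complex_hilbert \<Rightarrow> 'a \<Rightarrow> 'a"
  where "ball_aut x y =
    (let w = (1 / (1 - cinner y x)) *\<^sub>C (x - y)
     in sqrt (1 - (norm x)\<^sup>2) *\<^sub>R (w - proj_span x w) + proj_span x w)"

section \<open>Holomorphic and Bloch functions\<close>

text \<open>Functions on the unit ball are total functions of which only the values on
  \<^term>\<open>ball 0 1\<close> matter. \<^const>\<open>has_derivative\<close> is real Frechet differentiability, so
  complex linearity of the derivative is required separately.\<close>

definition holomorphic_on_ball :: "('a::complex_hilbert \<Rightarrow> complex) \<Rightarrow> bool"
  where "holomorphic_on_ball f \<longleftrightarrow>
    (\<forall>x\<in>ball 0 1. \<exists>f'. (f has_derivative f') (at x) \<and> (\<forall>c v. f' (c *\<^sub>C v) = c * f' v))"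

definition grad :: "('a::complex_hilbert \<Rightarrow> complex) \<Rightarrow> 'a \<Rightarrow> 'a \<Rightarrow> complex"
  where "grad f x = frechet_derivative f (at x)"

definition radial_deriv :: "('a::complex_hilbert \<Rightarrow> complex) \<Rightarrow> 'a \<Rightarrow> complex"
  where "radial_deriv f x = grad f x x"

definition bloch_space :: "('a::complex_hilbert \<Rightarrow> complex) set"
  where "bloch_space = {f. holomorphic_on_ball f \<and>
    bdd_above ((\<lambda>x. (1 - (norm x)\<^sup>2) * onorm (grad f x)) ` ball 0 1)}"

definition inv_grad :: "('a::complex_hilbert \<Rightarrow> complex) \<Rightarrow> 'a \<Rightarrow> 'a \<Rightarrow> complex"
  where "inv_grad f x = grad (f \<circ> ball_aut x) 0"

text \<open>A supremum of reals: it is meaningful when the invariant gradient is bounded on the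
  ball, as is the case for Bloch functions.\<close>

definition inv_seminorm :: "('a::complex_hilbert \<Rightarrow> complex) \<Rightarrow> real"
  where "inv_seminorm f = (SUP x\<in>ball 0 1. onorm (inv_grad f x))"

definition pseudohyp_lipschitz :: "('a::complex_hilbert \<Rightarrow> real) \<Rightarrow> bool"
  where "pseudohyp_lipschitz g \<longleftrightarrow>
    (\<exists>L\<ge>0. \<forall>x\<in>ball 0 1. \<forall>y\<in>ball 0 1. \<bar>g x - g y\<bar> \<le> L * pseudohyp_dist x y)"

end

theory Submission imports Defs "HOL-Complex_Analysis.Cauchy_Integral_Formula" begin

text \<open>Write \<open>M\<close> for the invariant seminorm of \<open>f\<close>, \<open>\<rho>\<close> for the pseudohyperbolic distance of
  \<open>x\<close> and \<open>y\<close>, and \<open>F x = (1 - |x|^2) f'(x) x\<close>. The seminorm controls the derivative of \<open>f\<close> by the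
  Bergman metric, \<open>|f'(z) v| \<le> M \<kappa>(z, v)\<close> with
  \<open>\<kappa>(z, v)^2 = (|v|^2 (1 - |z|^2) + |\<langle>v, z\<rangle>|^2) / (1 - |z|^2)^2\<close>, and \<open>\<kappa>(x, x) (1 - |x|^2) = |x| < 1\<close>, so \<open>|F| \<le> M\<close>.
  This settles the claim when \<open>\<rho> \<ge> 1/14\<close>, and only close points remain.

  The number \<open>F x\<close> is the derivative at \<open>\<zeta> = 0\<close> of \<open>f\<close> along the holomorphic disc
  \<open>\<zeta> \<mapsto> \<phi>\<^sub>x (- \<zeta> x) = (1 + \<zeta>) / (1 + \<zeta> |x|^2) x\<close>, so Cauchy's estimate on \<open>|\<zeta>| = 1/5\<close> bounds
  \<open>|F x - F y|\<close> by five times the largest difference of the values of \<open>f\<close> along the discs of \<open>x\<close> and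
  \<open>y\<close>. Two ingredients bound that difference.

  \<^item> Along a Euclidean segment from \<open>a\<close> to \<open>b\<close> the numerator of \<open>\<kappa>(z, b - a)^2\<close> is constant, because
  it is \<open>|a - b|^2\<close> minus a Gram determinant, and it equals \<open>(\<rho>(a, b) |1 - \<langle>a, b\<rangle>|)^2\<close>
  (\<open>segment_metric_const\<close>, \<open>pseudohyp_dist_sq\<close>). Integrating the derivative along the segment gives the
  Lipschitz estimate \<open>bloch_two_point_estimate\<close>.

  \<^item> For fixed \<open>\<zeta>\<close>, passing from \<open>(x, y)\<close> to the corresponding points on the two discs enlarges this
  quantity by a bounded factor (\<open>radial_disc_expansion\<close>).

  For \<open>|\<zeta>| = 1/5\<close> and \<open>\<rho> \<le> 1/14\<close> the factors multiply to less than \<open>14\<close>.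

  The supremum \<open>M\<close> has to be finite. In the direction of \<open>x\<close> this is the Bloch condition; orthogonally to
  \<open>x\<close> one needs that the derivative grows only like \<open>(1 - |x|^2)\<close> to the power \<open>-1/2\<close>. This gain over the
  Bloch condition comes from Cauchy's estimate on discs orthogonal to \<open>x\<close>, whose radius is comparable to
  the square root of the distance to the sphere (\<open>tangential_radial_increment\<close>), and from iterating it
  along the radius (\<open>tangential_derivative_bound_unit\<close>).\<close>

section \<open>Complex inner product spaces\<close>

lemma cinner_add_right: "cinner x (y + z) = cinner x y + cinner x z"
  for x :: "'a::complex_inner"
  by (metis cinner_commute cinner_add_left complex_cnj_add)

lemma cinner_scaleC_right: "cinner x (c *\<^sub>C y) = cnj c * cinner x y"
  for x :: "'a::complex_inner"
  by (metis cinner_commute cinner_scaleC_left complex_cnj_mult)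

lemma scaleC_zero_left [simp]: "0 *\<^sub>C x = (0::'a::complex_inner)"
  using scaleR_eq_scaleC[of 0 x] by simp

lemma scaleC_minus1: "(-1) *\<^sub>C x = - (x::'a::complex_inner)"
  using scaleR_eq_scaleC[of "-1" x] by simp

lemma scaleC_zero_right [simp]: "c *\<^sub>C 0 = (0::'a::complex_inner)"
  using scaleC_add_right[of c 0 "0::'a"] by simp

lemma cinner_zero_left [simp]: "cinner 0 x = 0"
  for x :: "'a::complex_inner"
  using cinner_scaleC_left[of 0 0 x] by simp

lemma cinner_minus_left: "cinner (- x) y = - cinner x y"
  for x :: "'a::complex_inner"
  using cinner_scaleC_left[of "-1" x y] by (simp add: scaleC_minus1)

lemma cinner_minus_right: "cinner x (- y) = - cinner x y"
  for x :: "'a::complex_inner"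
  using cinner_scaleC_right[of x "-1" y] by (simp add: scaleC_minus1)

lemma cinner_diff_left: "cinner (x - y) z = cinner x z - cinner y z"
  for x :: "'a::complex_inner"
  using cinner_add_left[of x "- y" z] by (simp add: cinner_minus_left)

lemma cinner_diff_right: "cinner x (y - z) = cinner x y - cinner x z"
  for x :: "'a::complex_inner"
  using cinner_add_right[of x y "- z"] by (simp add: cinner_minus_right)

lemma cinner_scaleR_left: "cinner (r *\<^sub>R x) y = of_real r * cinner x y"
  for x :: "'a::complex_inner"
  by (simp add: scaleR_eq_scaleC cinner_scaleC_left)

lemma cinner_scaleR_right: "cinner x (r *\<^sub>R y) = of_real r * cinner x y"
  for x :: "'a::complex_inner"
  by (simp add: scaleR_eq_scaleC cinner_scaleC_right)

lemmas cinner_simps = cinner_add_left cinner_add_right cinner_diff_left cinner_diff_right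
  cinner_scaleC_left cinner_scaleC_right cinner_scaleR_left cinner_scaleR_right
  cinner_minus_left cinner_minus_right

lemma Re_cinner_self: "Re (cinner x x) = (norm x)\<^sup>2"
  for x :: "'a::complex_inner"
  by (simp add: norm_eq_sqrt_cinner cinner_ge_zero)

lemma cinner_self: "cinner x x = of_real ((norm x)\<^sup>2)"
  for x :: "'a::complex_inner"
proof -
  have "Im (cinner x x) = 0"
    using arg_cong[OF cinner_commute[of x x], of Im] by simp
  then show ?thesis by (simp add: complex_eq_iff Re_cinner_self)
qed

lemma Re_cinner_commute: "Re (cinner y x) = Re (cinner x y)"
  for x :: "'a::complex_inner"
  by (subst cinner_commute) simp

lemma cmod_cinner_commute: "cmod (cinner y x) = cmod (cinner x y)"
  for x :: "'a::complex_inner"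
  by (subst cinner_commute) simp

lemma norm_scaleC: "norm (c *\<^sub>C x) = cmod c * norm x"
  for x :: "'a::complex_inner"
proof -
  have "(norm (c *\<^sub>C x))\<^sup>2 = Re (c * cnj c * cinner x x)"
    unfolding Re_cinner_self[symmetric] by (simp add: cinner_simps algebra_simps)
  also have "\<dots> = (cmod c * norm x)\<^sup>2"
    by (simp add: complex_mult_cnj cinner_self power_mult_distrib cmod_power2 flip: of_real_mult)
  finally show ?thesis by (simp add: power2_eq_iff_nonneg)
qed

lemma norm_add_sq: "(norm (x + y))\<^sup>2 = (norm x)\<^sup>2 + (norm y)\<^sup>2 + 2 * Re (cinner x y)"
  for x :: "'a::complex_inner"
  unfolding Re_cinner_self[symmetric] by (simp add: cinner_simps Re_cinner_commute[of x y])

lemma norm_diff_sq: "(norm (x - y))\<^sup>2 = (norm x)\<^sup>2 + (norm y)\<^sup>2 - 2 * Re (cinner x y)"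
  for x :: "'a::complex_inner"
  unfolding Re_cinner_self[symmetric] by (simp add: cinner_simps Re_cinner_commute[of x y])

lemma Cauchy_Schwarz_sq: "(cmod (cinner x y))\<^sup>2 \<le> (norm x)\<^sup>2 * (norm y)\<^sup>2"
  for x :: "'a::complex_inner"
proof (cases "y = 0")
  case True
  then show ?thesis using cinner_commute[of x y] by simp
next
  case False
  let ?q = "(norm y)\<^sup>2" and ?c = "cinner x y"
  have "(norm (?q *\<^sub>R x - ?c *\<^sub>C y))\<^sup>2 = ?q * ((norm x)\<^sup>2 * ?q - (cmod ?c)\<^sup>2)"
    unfolding norm_diff_sq
    by (simp add: norm_scaleC cinner_simps power_mult_distrib cmod_power2) algebra
  then have "0 \<le> ?q * ((norm x)\<^sup>2 * ?q - (cmod ?c)\<^sup>2)"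
    by (metis zero_le_power2)
  with False show ?thesis by (simp add: zero_le_mult_iff)
qed

lemma Cauchy_Schwarz: "cmod (cinner x y) \<le> norm x * norm y"
  for x :: "'a::complex_inner"
  by (rule power2_le_imp_le) (use Cauchy_Schwarz_sq[of x y] in \<open>auto simp: power_mult_distrib\<close>)

lemma bounded_linear_cinner_left: "bounded_linear (\<lambda>x. cinner x y)"
  for y :: "'a::complex_inner"
  by (rule bounded_linear_intro[of _ "norm y"])
    (auto simp: cinner_simps Cauchy_Schwarz scaleR_conv_of_real)

lemma bounded_bilinear_scaleC:
  "bounded_bilinear (scaleC :: complex \<Rightarrow> 'a::complex_inner \<Rightarrow> 'a)"
proof
  show "\<exists>K. \<forall>a b. norm (a *\<^sub>C b) \<le> norm a * norm (b::'a) * K"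
    by (rule exI[of _ 1]) (simp add: norm_scaleC)
  fix r :: real and a :: complex and b :: 'a
  show "(r *\<^sub>R a) *\<^sub>C b = r *\<^sub>R (a *\<^sub>C b)"
    by (simp add: scaleR_eq_scaleC[of r "_::'a"] scaleC_scaleC scaleR_conv_of_real)
  show "a *\<^sub>C (r *\<^sub>R b) = r *\<^sub>R (a *\<^sub>C b)"
    by (simp add: scaleR_eq_scaleC[of r "_::'a"] scaleC_scaleC mult.commute)
qed (auto simp: scaleC_add_left scaleC_add_right)

section \<open>The pseudohyperbolic distance and Gram determinants\<close>

lemma one_minus_norm_sq_pos: "0 < 1 - (norm x)\<^sup>2" if "x \<in> ball 0 1"
  using that by (simp add: abs_square_less_1)

text \<open>Adding a multiple of \<open>v\<close> to \<open>a\<close> does not change the Gram determinant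
  \<open>|v|^2 |a|^2 - |\<langle>v, a\<rangle>|^2\<close>, which for \<open>v = b - a\<close> is that of \<open>a\<close> and \<open>b\<close>. The left-hand side is the
  numerator of the squared Bergman metric at a point of the segment from \<open>a\<close> to \<open>b\<close>, in the direction of
  the segment; the denominator is \<open>(1 - |z|^2)^2\<close>.\<close>

lemma segment_metric_const:
  fixes a b :: "'a::complex_inner"
  defines "v \<equiv> b - a"
  shows "(norm v)\<^sup>2 * (1 - (norm (a + t *\<^sub>R v))\<^sup>2) + (cmod (cinner v (a + t *\<^sub>R v)))\<^sup>2 =
    (norm (a - b))\<^sup>2 - ((norm a)\<^sup>2 * (norm b)\<^sup>2 - (cmod (cinner a b))\<^sup>2)"
proof -
  have v: "(norm v)\<^sup>2 = (norm a)\<^sup>2 + (norm b)\<^sup>2 - 2 * Re (cinner a b)"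
    unfolding v_def norm_diff_sq by (simp add: Re_cinner_commute[of b a])
  have z: "(norm (a + t *\<^sub>R v))\<^sup>2 =
      (norm a)\<^sup>2 + t\<^sup>2 * (norm v)\<^sup>2 + 2 * t * (Re (cinner a b) - (norm a)\<^sup>2)"
    unfolding norm_add_sq by (simp add: cinner_simps power_mult_distrib v_def Re_cinner_self)
  have vz: "cinner v (a + t *\<^sub>R v) = cnj (cinner a b) - (norm a)\<^sup>2 + t * (norm v)\<^sup>2"
  proof -
    have "cinner v a = cnj (cinner a b) - (norm a)\<^sup>2"
      unfolding v_def by (simp add: cinner_diff_left cinner_self flip: cinner_commute)
    then show ?thesis by (simp add: cinner_add_right cinner_scaleR_right cinner_self)
  qed
  have "(cmod (cinner v (a + t *\<^sub>R v)))\<^sup>2 =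
      (Re (cinner a b) - (norm a)\<^sup>2 + t * (norm v)\<^sup>2)\<^sup>2 + (Im (cinner a b))\<^sup>2"
    unfolding vz cmod_power2 by simp
  then show ?thesis
    unfolding norm_diff_sq[of a b] z v cmod_power2[of "cinner a b"]
    by (simp add: power2_eq_square algebra_simps)
qed

text \<open>The quantity that the estimates below work with: cleared of its denominator, the squared
  distance becomes the constant of \<open>segment_metric_const\<close>, and is therefore nonnegative.\<close>

lemma pseudohyp_dist_sq:
  fixes x y :: "'a::complex_hilbert"
  assumes "x \<in> ball 0 1" "y \<in> ball 0 1"
  shows "0 \<le> pseudohyp_dist x y"
    and "cmod (1 - cinner x y) > 0"
    and "(pseudohyp_dist x y * cmod (1 - cinner x y))\<^sup>2 =
    (norm (x - y))\<^sup>2 - ((norm x)\<^sup>2 * (norm y)\<^sup>2 - (cmod (cinner x y))\<^sup>2)" (is "_ = ?d")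
proof -
  have "cmod (cinner x y) \<le> norm x * norm y" by (rule Cauchy_Schwarz)
  also have "\<dots> < 1 * 1" using assms by (intro mult_strict_mono') auto
  finally show pos: "cmod (1 - cinner x y) > 0" by auto
  have d: "?d = (cmod (1 - cinner x y))\<^sup>2 - (1 - (norm x)\<^sup>2) * (1 - (norm y)\<^sup>2)"
    unfolding norm_diff_sq[of x y] cmod_power2 by (simp add: power2_eq_square algebra_simps)
  have "0 \<le> ?d"
    using segment_metric_const[where a = x and b = y and t = 0, symmetric]
      one_minus_norm_sq_pos[OF assms(1)] by (simp add: add_nonneg_nonneg)
  moreover have "1 - (1 - (norm x)\<^sup>2) * (1 - (norm y)\<^sup>2) / (cmod (1 - cinner x y))\<^sup>2
      = ?d / (cmod (1 - cinner x y))\<^sup>2"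
    using pos unfolding d by (simp add: field_simps)
  ultimately have "pseudohyp_dist x y = sqrt (?d / (cmod (1 - cinner x y))\<^sup>2)"
    "0 \<le> ?d / (cmod (1 - cinner x y))\<^sup>2"
    unfolding pseudohyp_dist_def by (auto intro: divide_nonneg_nonneg)
  then show "0 \<le> pseudohyp_dist x y" "(pseudohyp_dist x y * cmod (1 - cinner x y))\<^sup>2 = ?d"
    using pos by (auto simp: power_mult_distrib)
qed

lemma pseudohyp_dist_commute: "pseudohyp_dist x y = pseudohyp_dist y x"
  for x y :: "'a::complex_hilbert"
proof -
  have "cmod (1 - cinner x y) = cmod (1 - cinner y x)"
    by (metis cinner_commute complex_cnj_diff complex_cnj_one complex_mod_cnj)
  then show ?thesis by (simp add: pseudohyp_dist_def mult.commute)
qed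

text \<open>The first bound is \<open>segment_metric_const\<close> at the end point \<open>x\<close>, with the first summand of the
  numerator dropped. It gives \<open>|1 - \<langle>x, y\<rangle>| \<le> 1 - |x|^2 + e\<close>, which is the second bound.\<close>

lemma pseudohyp_dist_bounds:
  fixes x y :: "'a::complex_hilbert"
  assumes "x \<in> ball 0 1" "y \<in> ball 0 1"
  defines "e \<equiv> pseudohyp_dist x y * cmod (1 - cinner x y)"
  shows "cmod ((norm x)\<^sup>2 - cinner x y) \<le> e"
    and "(1 - pseudohyp_dist x y) * e \<le> pseudohyp_dist x y * (1 - (norm x)\<^sup>2)"
proof -
  have "cmod (cinner (y - x) x) = cmod ((norm x)\<^sup>2 - cinner x y)"
    by (subst cmod_cinner_commute) (simp add: cinner_simps cinner_self norm_minus_commute)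
  moreover have "(cmod (cinner (y - x) x))\<^sup>2 \<le> e\<^sup>2"
  proof -
    have "e\<^sup>2 = (norm (y - x))\<^sup>2 * (1 - (norm x)\<^sup>2) + (cmod (cinner (y - x) x))\<^sup>2"
      using segment_metric_const[where a = x and b = y and t = 0]
      unfolding e_def pseudohyp_dist_sq(3)[OF assms(1,2)] scaleR_zero_left add_0_right by (rule sym)
    then show ?thesis using one_minus_norm_sq_pos[OF assms(1)] by simp
  qed
  ultimately have "(cmod ((norm x)\<^sup>2 - cinner x y))\<^sup>2 \<le> e\<^sup>2" by simp
  moreover have e: "0 \<le> e" using pseudohyp_dist_sq[OF assms(1,2)] by (simp add: e_def)
  ultimately show 1: "cmod ((norm x)\<^sup>2 - cinner x y) \<le> e"
    by (rule power2_le_imp_le)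
  have "cmod (1 - cinner x y) = cmod (of_real (1 - (norm x)\<^sup>2) + ((norm x)\<^sup>2 - cinner x y))"
    by simp
  also have "\<dots> \<le> (1 - (norm x)\<^sup>2) + e"
    using 1 one_minus_norm_sq_pos[OF assms(1)]
    by (intro order.trans[OF norm_triangle_ineq] add_mono) (auto simp del: of_real_diff)
  finally have "pseudohyp_dist x y * cmod (1 - cinner x y) \<le>
      pseudohyp_dist x y * ((1 - (norm x)\<^sup>2) + e)"
    using pseudohyp_dist_sq(1)[OF assms(1,2)] by (intro mult_left_mono)
  then show "(1 - pseudohyp_dist x y) * e \<le> pseudohyp_dist x y * (1 - (norm x)\<^sup>2)"
    unfolding e_def[symmetric] by (simp add: algebra_simps)
qed

section \<open>Holomorphic functions on the ball\<close>

lemma holomorphic_on_ball_grad: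
  assumes "holomorphic_on_ball f" "x \<in> ball 0 1"
  shows "(f has_derivative grad f x) (at x)" "grad f x (c *\<^sub>C v) = c * grad f x v"
proof -
  obtain f' where f': "(f has_derivative f') (at x)" "\<forall>c v. f' (c *\<^sub>C v) = c * f' v"
    using assms unfolding holomorphic_on_ball_def by blast
  moreover have "grad f x = f'"
    unfolding grad_def using frechet_derivative_at[OF f'(1)] by simp
  ultimately show "(f has_derivative grad f x) (at x)" "grad f x (c *\<^sub>C v) = c * grad f x v"
    by auto
qed

text \<open>Composition with a holomorphic disc reduces the theory on the ball to functions of one complex
  variable.\<close>

lemma has_field_derivative_along_disc:
  assumes "holomorphic_on_ball f" "\<gamma> z \<in> ball 0 1"
    and "(\<gamma> has_derivative (\<lambda>h. h *\<^sub>C w)) (at z)"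
  shows "((\<lambda>z. f (\<gamma> z)) has_field_derivative grad f (\<gamma> z) w) (at z)"
  using has_derivative_compose[OF assms(3) holomorphic_on_ball_grad(1)[OF assms(1,2)]]
  unfolding has_field_derivative_def
  by (simp add: holomorphic_on_ball_grad(2)[OF assms(1,2)] mult_commute_abs)

lemma has_derivative_scaleC_const:
  assumes "(g has_field_derivative d) (at z)"
  shows "((\<lambda>z. g z *\<^sub>C (x::'a::complex_inner)) has_derivative (\<lambda>h. h *\<^sub>C (d *\<^sub>C x))) (at z)"
proof -
  have "((\<lambda>z. g z *\<^sub>C x) has_derivative (\<lambda>h. (d * h) *\<^sub>C x)) (at z)"
    using bounded_linear.has_derivative[OF
        bounded_bilinear.bounded_linear_left[OF bounded_bilinear_scaleC, of x]
        assms[unfolded has_field_derivative_def]] by simp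
  then show ?thesis by (simp add: scaleC_scaleC mult.commute)
qed

lemma segment_mean_value:
  assumes "holomorphic_on_ball f" "a \<in> ball 0 1" "b \<in> ball 0 1"
    and "\<And>t. \<lbrakk>0 \<le> t; t \<le> 1\<rbrakk> \<Longrightarrow> cmod (grad f (a + t *\<^sub>R (b - a)) (b - a)) \<le> K"
  shows "cmod (f a - f b) \<le> K"
proof -
  let ?z = "\<lambda>t::real. a + t *\<^sub>R (b - a)"
  have inball: "?z t \<in> ball 0 1" if "0 \<le> t" "t \<le> 1" for t
    using convexD_alt[OF convex_ball assms(2,3) that] by (simp add: algebra_simps)
  have der: "((\<lambda>t. f (?z t)) has_derivative (\<lambda>h. h *\<^sub>R grad f (?z t) (b - a))) (at t)"
    if "0 \<le> t" "t \<le> 1" for t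
  proof -
    have "(?z has_derivative (\<lambda>h. h *\<^sub>R (b - a))) (at t)"
      by (auto intro!: derivative_eq_intros)
    from has_derivative_compose[OF this holomorphic_on_ball_grad(1)[OF assms(1) inball[OF that]]]
    show ?thesis
      by (simp add: linear_cmul[OF has_derivative_linear[OF
            holomorphic_on_ball_grad(1)[OF assms(1) inball[OF that]]]])
  qed
  have "norm (f (?z 0) - f (?z 1)) \<le> K * norm (0 - 1 :: real)"
  proof (rule differentiable_bound[of "{0..1}"])
    fix t :: real assume "t \<in> {0..1}"
    then have t: "0 \<le> t" "t \<le> 1" by auto
    show "((\<lambda>t. f (?z t)) has_derivative (\<lambda>h. h *\<^sub>R grad f (?z t) (b - a))) (at t within {0..1})"
      using der[OF t] by (rule has_derivative_at_withinI)
    show "onorm (\<lambda>h. h *\<^sub>R grad f (?z t) (b - a)) \<le> K"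
      by (rule onorm_le) (use assms(4)[OF t] in \<open>auto simp: mult.commute[of K] intro!: mult_left_mono\<close>)
  qed auto
  then show ?thesis by simp
qed

text \<open>Cauchy's inequality in the form needed when the derivative is known explicitly.\<close>

lemma Cauchy_estimate_deriv:
  assumes "0 < r" and "\<And>w. cmod w \<le> r \<Longrightarrow> (H has_field_derivative H' w) (at w)"
    and "\<And>w. cmod w = r \<Longrightarrow> cmod (H w) \<le> B"
  shows "cmod (H' 0) \<le> B / r"
proof -
  have "H holomorphic_on ball 0 r"
    using assms(2) by (force simp: holomorphic_on_open)
  moreover have "continuous_on (cball 0 r) H"
    by (intro continuous_at_imp_continuous_on ballI DERIV_isCont[OF assms(2)]) simp
  ultimately have "norm ((deriv ^^ 1) H 0) \<le> fact 1 * B / r ^ 1"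
    using assms by (intro Cauchy_inequality) auto
  moreover have "deriv H 0 = H' 0"
    using assms(1) by (intro DERIV_imp_deriv assms(2)) auto
  ultimately show ?thesis by simp
qed

section \<open>The invariant gradient\<close>

lemma proj_span_bounded_linear: "bounded_linear (proj_span (x::'a::complex_hilbert))"
proof (cases "x = 0")
  case True
  then show ?thesis by (simp add: proj_span_def[abs_def])
next
  case False
  have "bounded_linear (\<lambda>y. (cinner y x / cinner x x) *\<^sub>C x)"
    by (intro bounded_linear_compose[OF bounded_bilinear.bounded_linear_left[OF
          bounded_bilinear_scaleC]] bounded_linear_compose[OF bounded_linear_divide]
        bounded_linear_cinner_left)
  with False show ?thesis by (simp add: proj_span_def[abs_def])
qed

lemma proj_span_self: "proj_span x x = x"
  by (simp add: proj_span_def scaleC_one cinner_eq_zero_iff)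

lemma cinner_proj_span: "cinner y x *\<^sub>C x = (norm x)\<^sup>2 *\<^sub>R proj_span x y"
  by (cases "x = 0") (simp_all add: proj_span_def scaleR_eq_scaleC scaleC_scaleC cinner_self)

lemma proj_span_scaleC: "proj_span x (c *\<^sub>C y) = c *\<^sub>C proj_span x y"
  by (simp add: proj_span_def scaleC_scaleC cinner_simps)

lemma proj_span_idem: "proj_span x (proj_span x y) = proj_span x y"
proof (cases "x = 0")
  case False
  then show ?thesis
    by (simp add: proj_span_def[of x y] proj_span_scaleC proj_span_self)
qed (simp add: proj_span_def)

lemma cinner_minus_proj_span: "cinner (y - proj_span x y) x = 0"
  by (cases "x = 0") (simp_all add: proj_span_def cinner_simps cinner_eq_zero_iff
      cinner_commute[of y 0])

lemma norm_proj_span_decomp: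
  "(norm (\<alpha> *\<^sub>R proj_span x y + \<beta> *\<^sub>R (y - proj_span x y)))\<^sup>2 =
    \<alpha>\<^sup>2 * (norm (proj_span x y))\<^sup>2 + \<beta>\<^sup>2 * (norm (y - proj_span x y))\<^sup>2"
proof -
  have "cinner (y - proj_span x y) (proj_span x y) = 0"
    using cinner_minus_proj_span[of y x] unfolding proj_span_def[of x y]
    by (auto simp: cinner_scaleC_right)
  then have "cinner (proj_span x y) (y - proj_span x y) = 0"
    by (subst cinner_commute) simp
  then show ?thesis by (simp add: norm_add_sq power_mult_distrib cinner_simps)
qed

lemma norm_proj_span: "norm x * norm (proj_span x y) = cmod (cinner y x)"
proof (cases "x = 0")
  case False
  then show ?thesis
    by (simp add: proj_span_def norm_scaleC norm_divide norm_mult cinner_self power2_eq_square)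
next
  case True
  then show ?thesis by (simp add: cinner_commute[of y 0])
qed

lemma ball_aut_zero: "ball_aut x 0 = x"
  by (simp add: ball_aut_def proj_span_self scaleC_one)

lemma ball_aut_has_derivative_zero:
  fixes x :: "'a::complex_hilbert"
  assumes "x \<in> ball 0 1"
  defines "s \<equiv> sqrt (1 - (norm x)\<^sup>2)"
  shows "(ball_aut x has_derivative
    (\<lambda>v. - (s\<^sup>2 *\<^sub>R proj_span x v + s *\<^sub>R (v - proj_span x v)))) (at 0)"
proof -
  define w where "w y = (1 / (1 - cinner y x)) *\<^sub>C (x - y)" for y :: 'a
  define w' where "w' v = cinner v x *\<^sub>C x - v" for v :: 'a
  have c: "((\<lambda>y. cinner y x) has_derivative (\<lambda>v. cinner v x)) (at 0)"
    by (rule bounded_linear_imp_has_derivative[OF bounded_linear_cinner_left])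
  have "((\<lambda>y. 1 / (1 - cinner y x)) has_derivative (\<lambda>v. cinner v x)) (at 0)"
    by (rule derivative_eq_intros c refl | simp)+
  moreover have "((\<lambda>y. x - y) has_derivative (\<lambda>v. - v)) (at 0)"
    by (auto intro!: derivative_eq_intros)
  ultimately have w: "(w has_derivative w') (at 0)"
    using bounded_bilinear.FDERIV[OF bounded_bilinear_scaleC] unfolding w_def w'_def
    by (fastforce simp: scaleC_one)
  have P: "((\<lambda>y. proj_span x (w y)) has_derivative (\<lambda>v. proj_span x (w' v))) (at 0)"
    by (rule bounded_linear.has_derivative[OF proj_span_bounded_linear w])
  have "ball_aut x = (\<lambda>y. s *\<^sub>R (w y - proj_span x (w y)) + proj_span x (w y))"
    by (simp add: fun_eq_iff ball_aut_def w_def s_def Let_def)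
  moreover have "((\<lambda>y. s *\<^sub>R (w y - proj_span x (w y)) + proj_span x (w y)) has_derivative
      (\<lambda>v. s *\<^sub>R (w' v - proj_span x (w' v)) + proj_span x (w' v))) (at 0)"
    by (intro has_derivative_add has_derivative_scaleR_right has_derivative_diff w P)
  moreover have "s *\<^sub>R (w' v - proj_span x (w' v)) + proj_span x (w' v) =
      - (s\<^sup>2 *\<^sub>R proj_span x v + s *\<^sub>R (v - proj_span x v))" for v
  proof -
    interpret P: bounded_linear "proj_span x" by (rule proj_span_bounded_linear)
    have "s\<^sup>2 = 1 - (norm x)\<^sup>2"
      using one_minus_norm_sq_pos[OF assms(1)] by (simp add: s_def)
    moreover have "proj_span x (w' v) = ((norm x)\<^sup>2 - 1) *\<^sub>R proj_span x v"
      by (simp add: w'_def cinner_proj_span P.diff P.scaleR proj_span_idem algebra_simps)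
    moreover have "w' v = (norm x)\<^sup>2 *\<^sub>R proj_span x v - v"
      by (simp add: w'_def cinner_proj_span)
    ultimately show ?thesis
      by (simp only:) (simp add: algebra_simps)
  qed
  ultimately show ?thesis by simp
qed

text \<open>The derivative of the ball automorphism at the origin multiplies by \<open>- (1 - |x|^2)\<close> along \<open>x\<close> and
  by \<open>- sqrt (1 - |x|^2)\<close> orthogonally to \<open>x\<close>.\<close>

lemma inv_grad_eq:
  fixes x :: "'a::complex_hilbert"
  assumes "holomorphic_on_ball f" "x \<in> ball 0 1"
  defines "s \<equiv> sqrt (1 - (norm x)\<^sup>2)"
  shows "inv_grad f x = (\<lambda>v. - grad f x (s\<^sup>2 *\<^sub>R proj_span x v + s *\<^sub>R (v - proj_span x v)))"
    and "bounded_linear (inv_grad f x)"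
proof -
  note f = holomorphic_on_ball_grad(1)[OF assms(1,2)]
  have d: "((f \<circ> ball_aut x) has_derivative
      (\<lambda>v. grad f x (- (s\<^sup>2 *\<^sub>R proj_span x v + s *\<^sub>R (v - proj_span x v))))) (at 0)"
    using diff_chain_at[OF ball_aut_has_derivative_zero[OF assms(2)], of f "grad f x"] f
    by (simp add: ball_aut_zero s_def o_def)
  then have e: "inv_grad f x = (\<lambda>v. grad f x (- (s\<^sup>2 *\<^sub>R proj_span x v + s *\<^sub>R (v - proj_span x v))))"
    unfolding inv_grad_def grad_def[of "f \<circ> _"] by (rule frechet_derivative_at[symmetric])
  show "bounded_linear (inv_grad f x)"
    unfolding e by (rule has_derivative_bounded_linear[OF d])
  show "inv_grad f x = (\<lambda>v. - grad f x (s\<^sup>2 *\<^sub>R proj_span x v + s *\<^sub>R (v - proj_span x v)))"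
    unfolding e linear_neg[OF has_derivative_linear[OF f]] ..
qed

text \<open>Inverting the derivative of the automorphism: \<open>f'(x) v\<close> is, up to sign, the invariant gradient
  at the vector \<open>w\<close> below, and the norm of \<open>w\<close> is the Bergman metric of \<open>v\<close> at \<open>x\<close>.\<close>

lemma grad_le_inv_grad:
  fixes x :: "'a::complex_hilbert"
  assumes "holomorphic_on_ball f" "x \<in> ball 0 1"
  shows "cmod (grad f x v) \<le> onorm (inv_grad f x) *
    (sqrt ((norm v)\<^sup>2 * (1 - (norm x)\<^sup>2) + (cmod (cinner v x))\<^sup>2) / (1 - (norm x)\<^sup>2))"
proof -
  define s where "s = sqrt (1 - (norm x)\<^sup>2)"
  define w where "w = (1 / s\<^sup>2) *\<^sub>R proj_span x v + (1 / s) *\<^sub>R (v - proj_span x v)"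
  interpret P: bounded_linear "proj_span x" by (rule proj_span_bounded_linear)
  have s: "s > 0" "s\<^sup>2 = 1 - (norm x)\<^sup>2"
    using one_minus_norm_sq_pos[OF assms(2)] by (simp_all add: s_def)
  have "proj_span x w = (1 / s\<^sup>2) *\<^sub>R proj_span x v"
    by (simp add: w_def P.add P.scaleR P.diff proj_span_idem)
  then have "s\<^sup>2 *\<^sub>R proj_span x w + s *\<^sub>R (w - proj_span x w) = v"
    using s(1) by (simp add: w_def)
  then have "inv_grad f x w = - grad f x v"
    using inv_grad_eq(1)[OF assms] by (simp add: s_def)
  then have "cmod (grad f x v) \<le> onorm (inv_grad f x) * norm w"
    using onorm[OF inv_grad_eq(2)[OF assms], of w] by simp
  moreover have "(norm w)\<^sup>2 = (sqrt ((norm v)\<^sup>2 * s\<^sup>2 + (cmod (cinner v x))\<^sup>2) / s\<^sup>2)\<^sup>2"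
  proof -
    have "(norm v)\<^sup>2 = (norm (proj_span x v))\<^sup>2 + (norm (v - proj_span x v))\<^sup>2"
      using norm_proj_span_decomp[of 1 x v 1] by simp
    moreover have "(cmod (cinner v x))\<^sup>2 = (1 - s\<^sup>2) * (norm (proj_span x v))\<^sup>2"
      unfolding norm_proj_span[symmetric] s(2) by (simp add: power_mult_distrib)
    ultimately have "(norm v)\<^sup>2 * s\<^sup>2 + (cmod (cinner v x))\<^sup>2 =
        (norm (proj_span x v))\<^sup>2 + s\<^sup>2 * (norm (v - proj_span x v))\<^sup>2"
      by (simp add: algebra_simps)
    then show ?thesis
      using s(1) unfolding w_def norm_proj_span_decomp
      by (simp add: power_divide real_sqrt_pow2 field_simps power4_eq_xxxx power2_eq_square)
  qed
  then have "norm w = sqrt ((norm v)\<^sup>2 * s\<^sup>2 + (cmod (cinner v x))\<^sup>2) / s\<^sup>2"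
    by (rule power2_eq_imp_eq) auto
  ultimately show ?thesis by (simp add: s(2))
qed

section \<open>Bloch functions have bounded invariant gradient\<close>

lemma bloch_grad_bound:
  assumes "f \<in> bloch_space"
  obtains C where "0 \<le> C"
    and "\<And>x v. x \<in> ball 0 1 \<Longrightarrow> cmod (grad f x v) \<le> C * norm v / (1 - (norm x)\<^sup>2)"
proof -
  have hol: "holomorphic_on_ball f" using assms by (simp add: bloch_space_def)
  obtain C where C: "\<And>x. x \<in> ball 0 1 \<Longrightarrow> (1 - (norm x)\<^sup>2) * onorm (grad f x) \<le> C"
    using assms unfolding bloch_space_def bdd_above_def by blast
  have on: "bounded_linear (grad f x)" if "x \<in> ball 0 1" for x
    using holomorphic_on_ball_grad(1)[OF hol that] by (rule has_derivative_bounded_linear)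
  show thesis
  proof
    show "0 \<le> C"
      using C[of 0] onorm_pos_le[OF on[of 0]] by simp
    fix x v :: 'a assume x: "x \<in> ball 0 1"
    have "cmod (grad f x v) \<le> onorm (grad f x) * norm v" by (rule onorm[OF on[OF x]])
    also have "\<dots> \<le> (C / (1 - (norm x)\<^sup>2)) * norm v"
      using C[OF x] one_minus_norm_sq_pos[OF x]
      by (intro mult_right_mono) (simp_all add: field_simps)
    finally show "cmod (grad f x v) \<le> C * norm v / (1 - (norm x)\<^sup>2)" by simp
  qed
qed

text \<open>The difference of the two derivatives is the derivative at \<open>w = 0\<close> of
  \<open>f (x + w v) - f (t x + w v)\<close>. For \<open>|w| \<le> s / 2\<close> orthogonality keeps the points at distance comparable
  to \<open>s^2\<close> from the sphere, so the Bloch condition in the radial direction bounds the values, and Cauchy's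
  estimate costs a factor \<open>2 / s\<close> only.\<close>

lemma tangential_radial_increment:
  fixes x v :: "'a::complex_hilbert"
  assumes hol: "holomorphic_on_ball f" and "0 \<le> C"
    and C: "\<And>x v. x \<in> ball 0 1 \<Longrightarrow> cmod (grad f x v) \<le> C * norm v / (1 - (norm x)\<^sup>2)"
    and x: "x \<in> ball 0 1" and xv: "cinner x v = 0" and v: "norm v = 1"
    and t: "0 \<le> t" "t \<le> 1"
  defines "s \<equiv> sqrt (1 - (norm x)\<^sup>2)"
  shows "cmod (grad f x v - grad f (t *\<^sub>R x) v) \<le> 8 * C * ((1 - t) * norm x) / (3 * s ^ 3)"
proof -
  have s: "s > 0" "s\<^sup>2 = 1 - (norm x)\<^sup>2"
    using one_minus_norm_sq_pos[OF x] by (simp_all add: s_def)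
  have gap: "3 / 4 * s\<^sup>2 \<le> 1 - (norm (\<tau> *\<^sub>R x + w *\<^sub>C v))\<^sup>2" "\<tau> *\<^sub>R x + w *\<^sub>C v \<in> ball 0 1"
    if "0 \<le> \<tau>" "\<tau> \<le> 1" "cmod w \<le> s / 2" for \<tau> w
  proof -
    have "(norm (\<tau> *\<^sub>R x + w *\<^sub>C v))\<^sup>2 = \<tau>\<^sup>2 * (norm x)\<^sup>2 + (cmod w)\<^sup>2"
      by (simp add: norm_add_sq cinner_simps xv norm_scaleC v power_mult_distrib)
    moreover have "\<tau>\<^sup>2 * (norm x)\<^sup>2 \<le> 1 * (norm x)\<^sup>2"
      using that by (intro mult_right_mono) (simp_all add: power_le_one)
    moreover have "(cmod w)\<^sup>2 \<le> (s / 2)\<^sup>2"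
      using that by (intro power_mono) auto
    ultimately show 1: "3 / 4 * s\<^sup>2 \<le> 1 - (norm (\<tau> *\<^sub>R x + w *\<^sub>C v))\<^sup>2"
      using s(2) by (simp add: power_divide)
    then have "(norm (\<tau> *\<^sub>R x + w *\<^sub>C v))\<^sup>2 < 1"
      using zero_less_power[OF s(1), of 2] by linarith
    then show "\<tau> *\<^sub>R x + w *\<^sub>C v \<in> ball 0 1" by (simp add: abs_square_less_1)
  qed
  have der: "((\<lambda>w. f (\<tau> *\<^sub>R x + w *\<^sub>C v)) has_field_derivative grad f (\<tau> *\<^sub>R x + w *\<^sub>C v) v) (at w)"
    if "0 \<le> \<tau>" "\<tau> \<le> 1" "cmod w \<le> s / 2" for \<tau> w
  proof (rule has_field_derivative_along_disc[where
        \<gamma> = "\<lambda>w. \<tau> *\<^sub>R x + w *\<^sub>C v", OF hol gap(2)[OF that]])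
    have "((\<lambda>w. w *\<^sub>C v) has_derivative (\<lambda>h. h *\<^sub>C v)) (at w)"
      using has_derivative_scaleC_const[OF DERIV_ident, of v w] by (simp add: scaleC_one)
    from has_derivative_add[OF has_derivative_const this]
    show "((\<lambda>w. \<tau> *\<^sub>R x + w *\<^sub>C v) has_derivative (\<lambda>h. h *\<^sub>C v)) (at w)" by simp
  qed
  define B where "B = 4 * C * ((1 - t) * norm x) / (3 * s\<^sup>2)"
  have "cmod (grad f (1 *\<^sub>R x + 0 *\<^sub>C v) v - grad f (t *\<^sub>R x + 0 *\<^sub>C v) v) \<le> B / (s / 2)"
  proof (rule Cauchy_estimate_deriv[where
        H = "\<lambda>w. f (1 *\<^sub>R x + w *\<^sub>C v) - f (t *\<^sub>R x + w *\<^sub>C v)"])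
    show "((\<lambda>w. f (1 *\<^sub>R x + w *\<^sub>C v) - f (t *\<^sub>R x + w *\<^sub>C v)) has_field_derivative
        grad f (1 *\<^sub>R x + w *\<^sub>C v) v - grad f (t *\<^sub>R x + w *\<^sub>C v) v) (at w)"
      if "cmod w \<le> s / 2" for w
      by (rule DERIV_diff) (rule der; use t that in simp)+
    fix w assume w: "cmod w = s / 2"
    show "cmod (f (1 *\<^sub>R x + w *\<^sub>C v) - f (t *\<^sub>R x + w *\<^sub>C v)) \<le> B"
    proof (rule segment_mean_value[OF hol])
      fix u :: real assume u: "0 \<le> u" "u \<le> 1"
      let ?\<tau> = "1 - u * (1 - t)"
      let ?d = "t *\<^sub>R x + w *\<^sub>C v - (1 *\<^sub>R x + w *\<^sub>C v)"
      have z: "1 *\<^sub>R x + w *\<^sub>C v + u *\<^sub>R ?d = ?\<tau> *\<^sub>R x + w *\<^sub>C v"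
        by (simp add: algebra_simps)
      have "?d = (t - 1) *\<^sub>R x" by (simp add: algebra_simps)
      then have d: "norm ?d = (1 - t) * norm x" using t by simp
      have "u * (1 - t) \<le> 1 * 1" using u t by (intro mult_mono) auto
      moreover have "0 \<le> u * (1 - t)" using u t by simp
      ultimately have \<tau>: "0 \<le> ?\<tau>" "?\<tau> \<le> 1" by auto
      have "cmod (grad f (?\<tau> *\<^sub>R x + w *\<^sub>C v) ?d) \<le>
          C * norm ?d / (1 - (norm (?\<tau> *\<^sub>R x + w *\<^sub>C v))\<^sup>2)"
        by (rule C) (rule gap(2); use \<tau> w in simp)
      also have "\<dots> \<le> C * norm ?d / (3 / 4 * s\<^sup>2)"
        using s(1) by (intro frac_le mult_nonneg_nonneg norm_ge_zero \<open>0 \<le> C\<close> gap(1)[OF \<tau>])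
          (simp_all add: w)
      also have "\<dots> = B" unfolding d B_def by simp
      finally show "cmod (grad f (1 *\<^sub>R x + w *\<^sub>C v + u *\<^sub>R ?d) ?d) \<le> B"
        unfolding z .
    qed (rule gap(2); use t w in simp)+
  qed (use s in auto)
  then show ?thesis by (simp add: B_def power3_eq_cube power2_eq_square field_simps)
qed

text \<open>Moving \<open>x\<close> towards the origin until \<open>1 - |x|^2\<close> has become four times as large doubles the weight
  \<open>s\<close>. Hence the bound at the new point contributes only half of it at the old one, and
  \<open>tangential_radial_increment\<close> adds at most \<open>16 C\<close>; the constant \<open>32 C\<close> is the fixed point of
  \<open>K \<mapsto> K / 2 + 16 C\<close>. The induction is on the number of such moves.\<close>

lemma tangential_derivative_bound_unit:
  fixes x v :: "'a::complex_hilbert"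
  assumes hol: "holomorphic_on_ball f" and "0 \<le> C"
    and C: "\<And>x v. x \<in> ball 0 1 \<Longrightarrow> cmod (grad f x v) \<le> C * norm v / (1 - (norm x)\<^sup>2)"
    and v: "norm v = 1"
  shows "\<lbrakk>x \<in> ball 0 1; cinner x v = 0; 1 \<le> 4 ^ n * (1 - (norm x)\<^sup>2)\<rbrakk>
    \<Longrightarrow> sqrt (1 - (norm x)\<^sup>2) * cmod (grad f x v) \<le> 32 * C"
proof (induction n arbitrary: x)
  case 0
  then have "x = 0" by simp
  then show ?case using C[of 0 v] v \<open>0 \<le> C\<close> by simp
next
  case (Suc n)
  note x = Suc.prems(1) and xv = Suc.prems(2)
  define s where "s = sqrt (1 - (norm x)\<^sup>2)"
  have s: "s > 0" "s\<^sup>2 = 1 - (norm x)\<^sup>2"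
    using one_minus_norm_sq_pos[OF x] by (simp_all add: s_def)
  show ?case
  proof (cases "1 / 2 \<le> s")
    case True
    have "s * cmod (grad f x v) \<le> s * (C / s\<^sup>2)"
      using C[OF x, of v] s v by (intro mult_left_mono) auto
    also have "\<dots> = C / s" using s(1) by (simp add: power2_eq_square)
    also have "\<dots> \<le> C / (1 / 2)"
      using True \<open>0 \<le> C\<close> by (intro divide_left_mono) auto
    also have "\<dots> \<le> 32 * C" using \<open>0 \<le> C\<close> by simp
    finally show ?thesis by (simp add: s_def)
  next
    case False
    define r where "r = sqrt (1 - 4 * s\<^sup>2)"
    define t where "t = r / norm x"
    have "s\<^sup>2 < (1 / 2)\<^sup>2" using False s(1) by (intro power_strict_mono) auto
    then have s4: "4 * s\<^sup>2 < 1" by (simp add: power2_eq_square)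
    then have r: "0 \<le> r" "r\<^sup>2 = 1 - 4 * s\<^sup>2" by (simp_all add: r_def)
    have "(1 / 2)\<^sup>2 \<le> (norm x)\<^sup>2" using s4 s(2) by (simp add: power2_eq_square)
    then have nx: "1 / 2 \<le> norm x" by (rule power2_le_imp_le) simp
    have "r\<^sup>2 \<le> (norm x)\<^sup>2" using r(2) s(2) one_minus_norm_sq_pos[OF x] by simp
    then have rx: "r \<le> norm x" by (rule power2_le_imp_le) simp
    have x0: "norm x > 0" using nx by linarith
    have t: "0 \<le> t" "t \<le> 1" using r rx x0 by (simp_all add: t_def)
    have ntx: "norm (t *\<^sub>R x) = r" using r(1) x0 by (simp add: t_def)
    have tx: "t *\<^sub>R x \<in> ball 0 1" "1 - (norm (t *\<^sub>R x))\<^sup>2 = (2 * s)\<^sup>2"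
      using ntx rx x r(2) by (simp_all add: power_mult_distrib)
    have "sqrt (1 - (norm (t *\<^sub>R x))\<^sup>2) * cmod (grad f (t *\<^sub>R x) v) \<le> 32 * C"
    proof (rule Suc.IH[OF tx(1)])
      show "cinner (t *\<^sub>R x) v = 0" by (simp add: cinner_simps xv)
      show "1 \<le> 4 ^ n * (1 - (norm (t *\<^sub>R x))\<^sup>2)"
        using Suc.prems(3) unfolding tx(2) s(2)[symmetric] by (simp add: power_mult_distrib)
    qed
    then have IH: "s * cmod (grad f (t *\<^sub>R x) v) \<le> 16 * C"
      unfolding tx(2) real_sqrt_abs using s(1) by simp
    have "(norm x - r) * (1 / 2) \<le> (norm x - r) * (norm x + r)"
      using nx r(1) rx by (intro mult_left_mono) auto
    also have "\<dots> = 3 * s\<^sup>2"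
      using r(2) s(2) by (simp add: algebra_simps power2_eq_square)
    finally have step: "(1 - t) * norm x \<le> 6 * s\<^sup>2"
      using x0 by (simp add: t_def algebra_simps)
    have "cmod (grad f x v - grad f (t *\<^sub>R x) v) \<le> 8 * C * ((1 - t) * norm x) / (3 * s ^ 3)"
      using tangential_radial_increment[OF hol \<open>0 \<le> C\<close> C x xv v t] by (simp add: s_def)
    also have "\<dots> \<le> 8 * C * (6 * s\<^sup>2) / (3 * s ^ 3)"
      using step \<open>0 \<le> C\<close> s(1) by (intro divide_right_mono mult_left_mono) auto
    also have "\<dots> = 16 * C / s"
      using s(1) by (simp add: power3_eq_cube power2_eq_square)
    finally have "cmod (grad f x v) \<le> 16 * C / s + cmod (grad f (t *\<^sub>R x) v)"
      using norm_triangle_ineq2[of "grad f x v" "grad f (t *\<^sub>R x) v"] by linarith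
    then have "s * cmod (grad f x v) \<le> s * (16 * C / s + cmod (grad f (t *\<^sub>R x) v))"
      using s(1) by (intro mult_left_mono) auto
    also have "\<dots> = 16 * C + s * cmod (grad f (t *\<^sub>R x) v)"
      using s(1) by (simp add: algebra_simps)
    finally show ?thesis using IH by (simp add: s_def)
  qed
qed

lemma tangential_derivative_bound:
  fixes x v :: "'a::complex_hilbert"
  assumes hol: "holomorphic_on_ball f" and "0 \<le> C"
    and C: "\<And>x v. x \<in> ball 0 1 \<Longrightarrow> cmod (grad f x v) \<le> C * norm v / (1 - (norm x)\<^sup>2)"
    and x: "x \<in> ball 0 1" and vx: "cinner v x = 0"
  shows "sqrt (1 - (norm x)\<^sup>2) * cmod (grad f x v) \<le> 32 * C * norm v"
proof (cases "v = 0")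
  case True
  then show ?thesis using C[OF x, of v] by simp
next
  case False
  define u where "u = complex_of_real (1 / norm v) *\<^sub>C v"
  have u: "norm u = 1" "v = complex_of_real (norm v) *\<^sub>C u" "cinner x u = 0"
    using False cinner_commute[of x v] vx
    by (simp_all add: u_def norm_scaleC norm_divide scaleC_scaleC scaleC_one cinner_simps)
  obtain n :: nat where "1 / (1 - (norm x)\<^sup>2) < 4 ^ n"
    using real_arch_pow[of 4] by auto
  then have "1 \<le> 4 ^ n * (1 - (norm x)\<^sup>2)"
    using one_minus_norm_sq_pos[OF x] by (simp add: field_simps)
  from tangential_derivative_bound_unit[OF hol \<open>0 \<le> C\<close> C u(1) x u(3) this]
  have "norm v * (sqrt (1 - (norm x)\<^sup>2) * cmod (grad f x u)) \<le> norm v * (32 * C)"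
    by (intro mult_left_mono) auto
  moreover have "cmod (grad f x v) = norm v * cmod (grad f x u)"
    by (subst u(2)) (simp add: holomorphic_on_ball_grad(2)[OF hol x] norm_mult)
  ultimately show ?thesis by (simp add: mult_ac)
qed

text \<open>Along \<open>x\<close> the weight of the invariant gradient is that of the Bloch condition; orthogonally to \<open>x\<close>
  the tangential bound applies. Without this the supremum defining the seminorm would carry no
  information.\<close>

lemma bloch_inv_grad_bdd:
  assumes "f \<in> bloch_space"
  shows "bdd_above ((\<lambda>x. onorm (inv_grad f x)) ` ball 0 1)"
proof -
  have hol: "holomorphic_on_ball f" using assms by (simp add: bloch_space_def)
  obtain C where C0: "0 \<le> C"
    and C: "\<And>x v. x \<in> ball 0 1 \<Longrightarrow> cmod (grad f x v) \<le> C * norm v / (1 - (norm x)\<^sup>2)"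
    using bloch_grad_bound[OF assms] by blast
  have "onorm (inv_grad f x) \<le> 33 * C" if x: "x \<in> ball 0 1" for x
  proof (rule onorm_bound)
    show "0 \<le> 33 * C" using C0 by simp
    fix v
    define s where "s = sqrt (1 - (norm x)\<^sup>2)"
    let ?P = "proj_span x v" and ?Q = "v - proj_span x v"
    have s: "s > 0" "s\<^sup>2 = 1 - (norm x)\<^sup>2"
      using one_minus_norm_sq_pos[OF x] by (simp_all add: s_def)
    have lin: "linear (grad f x)"
      using holomorphic_on_ball_grad(1)[OF hol x] by (rule has_derivative_linear)
    have "(norm v)\<^sup>2 = (norm ?P)\<^sup>2 + (norm ?Q)\<^sup>2"
      using norm_proj_span_decomp[of 1 x v 1] by simp
    then have "norm ?P \<le> norm v" "norm ?Q \<le> norm v"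
      by (auto intro: power2_le_imp_le)
    moreover have "s\<^sup>2 * cmod (grad f x ?P) \<le> C * norm ?P"
      using C[OF x, of ?P] s(1) unfolding s(2)[symmetric]
      by (simp add: pos_le_divide_eq mult.commute)
    moreover have "s * cmod (grad f x ?Q) \<le> 32 * C * norm ?Q"
      using tangential_derivative_bound[OF hol C0 C x cinner_minus_proj_span] by (simp add: s_def)
    moreover have "cmod (inv_grad f x v) \<le> s\<^sup>2 * cmod (grad f x ?P) + s * cmod (grad f x ?Q)"
      using norm_triangle_ineq[of "s\<^sup>2 *\<^sub>R grad f x ?P" "s *\<^sub>R grad f x ?Q"] s(1)
      by (simp add: inv_grad_eq(1)[OF hol x] linear_add[OF lin] linear_cmul[OF lin] flip: s_def
          del: minus_add_distrib add_uminus_conv_diff)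
    ultimately have "cmod (inv_grad f x v) \<le> C * norm v + 32 * C * norm v"
      using C0 by (smt (verit) mult_left_mono mult_nonneg_nonneg)
    then show "cmod (inv_grad f x v) \<le> 33 * C * norm v" by (simp add: algebra_simps)
  qed
  then show ?thesis by (auto intro!: bdd_aboveI)
qed

lemma inv_grad_le_seminorm:
  assumes "f \<in> bloch_space" "x \<in> ball 0 1"
  shows "onorm (inv_grad f x) \<le> inv_seminorm f"
  unfolding inv_seminorm_def by (rule cSUP_upper[OF assms(2) bloch_inv_grad_bdd[OF assms(1)]])

lemma bloch_grad_le_seminorm:
  fixes x v :: "'a::complex_hilbert"
  assumes "f \<in> bloch_space" "x \<in> ball 0 1"
  shows "cmod (grad f x v) \<le> inv_seminorm f *
    (sqrt ((norm v)\<^sup>2 * (1 - (norm x)\<^sup>2) + (cmod (cinner v x))\<^sup>2) / (1 - (norm x)\<^sup>2))"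
proof -
  have "holomorphic_on_ball f" using assms by (simp add: bloch_space_def)
  then show ?thesis
    using one_minus_norm_sq_pos[OF assms(2)]
    by (intro order.trans[OF grad_le_inv_grad] mult_right_mono inv_grad_le_seminorm assms) auto
qed

lemma inv_seminorm_nonneg: "f \<in> bloch_space \<Longrightarrow> 0 \<le> inv_seminorm f"
  using inv_grad_le_seminorm[of f 0] inv_grad_eq(2)[of f 0]
  by (auto simp: bloch_space_def intro: order.trans[OF onorm_pos_le])

section \<open>The radial derivative and the pseudohyperbolic distance\<close>

text \<open>The numerator of the squared Bergman metric is at most \<open>e^2\<close> on the whole segment, and
  \<open>1 - |z|^2\<close> is smallest at an end point by convexity of the norm.\<close>

lemma bloch_two_point_estimate:
  fixes a b :: "'a::complex_hilbert"
  assumes f: "f \<in> bloch_space" and a: "a \<in> ball 0 1" and b: "b \<in> ball 0 1" and "0 \<le> e"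
    and e: "(norm (a - b))\<^sup>2 - ((norm a)\<^sup>2 * (norm b)\<^sup>2 - (cmod (cinner a b))\<^sup>2) \<le> e\<^sup>2"
    and ea: "e \<le> K * (1 - (norm a)\<^sup>2)" and eb: "e \<le> K * (1 - (norm b)\<^sup>2)"
  shows "cmod (f a - f b) \<le> inv_seminorm f * K"
proof (rule segment_mean_value[OF _ a b])
  show "holomorphic_on_ball f" using f by (simp add: bloch_space_def)
  fix t :: real assume t: "0 \<le> t" "t \<le> 1"
  let ?z = "a + t *\<^sub>R (b - a)"
  have z: "?z = (1 - t) *\<^sub>R a + t *\<^sub>R b" by (simp add: algebra_simps)
  have zb: "?z \<in> ball 0 1" unfolding z by (rule convexD_alt[OF convex_ball a b t])
  note pos = one_minus_norm_sq_pos[OF zb]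
  have "0 \<le> K * (1 - (norm a)\<^sup>2)" using \<open>0 \<le> e\<close> ea by simp
  then have K: "0 \<le> K" using one_minus_norm_sq_pos[OF a] by (simp add: zero_le_mult_iff)
  have "norm ?z \<le> (1 - t) * norm a + t * norm b"
    unfolding z using t by (intro order.trans[OF norm_triangle_ineq]) simp
  also have "\<dots> \<le> max (norm a) (norm b)" using t by (intro convex_bound_le) auto
  finally have "norm ?z \<le> norm a \<or> norm ?z \<le> norm b" by auto
  then have "(norm ?z)\<^sup>2 \<le> (norm a)\<^sup>2 \<or> (norm ?z)\<^sup>2 \<le> (norm b)\<^sup>2"
    by (auto intro: power_mono)
  then have "e \<le> K * (1 - (norm ?z)\<^sup>2)"
    using ea eb K by (smt (verit) mult_left_mono)
  moreover have "sqrt ((norm (b - a))\<^sup>2 * (1 - (norm ?z)\<^sup>2) + (cmod (cinner (b - a) ?z))\<^sup>2) \<le> e"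
    unfolding segment_metric_const using e \<open>0 \<le> e\<close> by (rule real_le_lsqrt[rotated -1]) 
  ultimately have "sqrt ((norm (b - a))\<^sup>2 * (1 - (norm ?z)\<^sup>2) + (cmod (cinner (b - a) ?z))\<^sup>2)
      / (1 - (norm ?z)\<^sup>2) \<le> K"
    using pos by (simp add: divide_le_eq)
  then show "cmod (grad f ?z (b - a)) \<le> inv_seminorm f * K"
    by (intro order.trans[OF bloch_grad_le_seminorm[OF f zb]] mult_left_mono
        inv_seminorm_nonneg f)
qed

text \<open>This is \<open>\<phi>\<^sub>x (- \<zeta> x)\<close>, the image under the ball automorphism at \<open>x\<close> of a disc in the complex line
  through \<open>x\<close>. Its derivative at \<open>\<zeta> = 0\<close> is \<open>(1 - |x|^2) x\<close>, the weighted radial direction.\<close>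

definition radial_disc :: "'a::complex_hilbert \<Rightarrow> complex \<Rightarrow> 'a"
  where "radial_disc x \<zeta> = ((1 + \<zeta>) / (1 + \<zeta> * (norm x)\<^sup>2)) *\<^sub>C x"

lemma radial_disc_denom_bounds:
  fixes p :: real
  assumes "cmod \<zeta> \<le> r" "0 \<le> p" "p \<le> 1"
  shows "1 - r \<le> cmod (1 + \<zeta> * p)" "cmod (1 + \<zeta> * p) \<le> 1 + r"
proof -
  have "cmod (\<zeta> * p) \<le> r * 1"
    unfolding norm_mult using assms order.trans[OF norm_ge_zero assms(1)]
    by (intro mult_mono) auto
  then show "1 - r \<le> cmod (1 + \<zeta> * p)" "cmod (1 + \<zeta> * p) \<le> 1 + r"
    using norm_triangle_ineq[of 1 "\<zeta> * p"] norm_diff_ineq[of 1 "\<zeta> * p"] by auto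
qed

lemma one_minus_norm_radial_disc:
  fixes \<zeta> :: complex
  assumes "1 + \<zeta> * (norm x)\<^sup>2 \<noteq> 0"
  shows "1 - (norm (radial_disc x \<zeta>))\<^sup>2 =
    (1 - (norm x)\<^sup>2) * (1 - (cmod \<zeta>)\<^sup>2 * (norm x)\<^sup>2) / (cmod (1 + \<zeta> * (norm x)\<^sup>2))\<^sup>2"
proof -
  define p where "p = (norm x)\<^sup>2"
  have "(norm (radial_disc x \<zeta>))\<^sup>2 = (cmod (1 + \<zeta>))\<^sup>2 * p / (cmod (1 + \<zeta> * p))\<^sup>2"
    by (simp add: radial_disc_def norm_scaleC norm_divide power_mult_distrib power_divide p_def)
  moreover have "(cmod (1 + \<zeta> * p))\<^sup>2 - (cmod (1 + \<zeta>))\<^sup>2 * p = (1 - p) * (1 - (cmod \<zeta>)\<^sup>2 * p)"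
    unfolding cmod_power2 by (simp add: power2_eq_square algebra_simps)
  moreover have "(cmod (1 + \<zeta> * p))\<^sup>2 \<noteq> 0" using assms by (simp add: p_def)
  ultimately show ?thesis unfolding p_def[symmetric] by (simp add: field_simps)
qed

text \<open>The map \<open>x \<mapsto> radial_disc x \<zeta>\<close> is not holomorphic in \<open>x\<close>, so the Schwarz-Pick lemma does not
  apply, but the quantity of \<open>segment_metric_const\<close> can be computed. With \<open>p = |x|^2\<close>, \<open>q = |y|^2\<close>,
  \<open>c = \<langle>x, y\<rangle>\<close> and \<open>G = p q - |c|^2\<close> it is, up to the displayed denominators and \<open>|1 + \<zeta>|^2\<close>,
  \<open>e^2 (1 + |\<zeta>|^2 p q) - |\<zeta>|^2 (1 - p q) G + 2 Re (cnj \<zeta> (p - cnj c) (q - c))\<close>.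
  The middle term has the right sign and \<open>|p - c|, |q - c| \<le> e\<close>, which leaves \<open>(1 + r)^2 e^2\<close>.\<close>

lemma radial_disc_expansion:
  fixes x y :: "'a::complex_hilbert"
  assumes x: "x \<in> ball 0 1" and y: "y \<in> ball 0 1" and r: "cmod \<zeta> \<le> r"
    and nz: "1 + \<zeta> * (norm x)\<^sup>2 \<noteq> 0" "1 + \<zeta> * (norm y)\<^sup>2 \<noteq> 0"
  defines "a \<equiv> radial_disc x \<zeta>" and "b \<equiv> radial_disc y \<zeta>"
    and "e \<equiv> pseudohyp_dist x y * cmod (1 - cinner x y)"
  shows "(norm (a - b))\<^sup>2 - ((norm a)\<^sup>2 * (norm b)\<^sup>2 - (cmod (cinner a b))\<^sup>2) \<le>
    (cmod (1 + \<zeta>) * (1 + r) * e / (cmod (1 + \<zeta> * (norm x)\<^sup>2) * cmod (1 + \<zeta> * (norm y)\<^sup>2)))\<^sup>2"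
proof -
  define p q c where "p = (norm x)\<^sup>2" and "q = (norm y)\<^sup>2" and "c = cinner x y"
  define D where "D = (cmod (1 + \<zeta> * p))\<^sup>2 * (cmod (1 + \<zeta> * q))\<^sup>2"
  define G where "G = p * q - (cmod c)\<^sup>2"
  define \<alpha> \<beta> where "\<alpha> = (1 + \<zeta>) / (1 + \<zeta> * p)" and "\<beta> = (1 + \<zeta>) / (1 + \<zeta> * q)"
  have ab: "a = \<alpha> *\<^sub>C x" "b = \<beta> *\<^sub>C y"
    by (simp_all add: a_def b_def radial_disc_def \<alpha>_def \<beta>_def p_def q_def)
  have nz': "1 + \<zeta> * p \<noteq> 0" "1 + \<zeta> * q \<noteq> 0" using nz by (simp_all add: p_def q_def)
  then have D: "0 < D" by (simp add: D_def)
  have pq: "0 \<le> p" "p \<le> 1" "0 \<le> q" "q \<le> 1"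
    using one_minus_norm_sq_pos[OF x] one_minus_norm_sq_pos[OF y] by (simp_all add: p_def q_def)
  have r0: "0 \<le> r" using r by (smt (verit) norm_ge_zero)
  have G: "0 \<le> G" using Cauchy_Schwarz_sq[of x y] by (simp add: G_def p_def q_def c_def)
  have e0: "0 \<le> e" using pseudohyp_dist_sq[OF x y] by (simp add: e_def)
  have e2: "e\<^sup>2 = p + q - 2 * Re c - G"
    unfolding e_def pseudohyp_dist_sq(3)[OF x y] norm_diff_sq[of x y] p_def q_def c_def G_def by simp
  have ep: "cmod (p - c) \<le> e"
    using pseudohyp_dist_bounds(1)[OF x y] by (simp add: e_def p_def c_def)
  have "cmod (1 - cinner y x) = cmod (1 - cinner x y)" "cmod (q - cinner y x) = cmod (q - c)"
    unfolding c_def cinner_commute[of y x] by (metis complex_cnj_diff complex_cnj_one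
        complex_mod_cnj complex_cnj_complex_of_real)+
  then have eq: "cmod (q - c) \<le> e"
    using pseudohyp_dist_bounds(1)[OF y x] pseudohyp_dist_commute[of x y] by (simp add: e_def q_def)
  have \<alpha>: "(cmod \<alpha>)\<^sup>2 * D = (cmod (1 + \<zeta>))\<^sup>2 * (cmod (1 + \<zeta> * q))\<^sup>2"
    and \<beta>: "(cmod \<beta>)\<^sup>2 * D = (cmod (1 + \<zeta>))\<^sup>2 * (cmod (1 + \<zeta> * p))\<^sup>2"
    and \<alpha>\<beta>: "(cmod \<alpha>)\<^sup>2 * (cmod \<beta>)\<^sup>2 * D = ((cmod (1 + \<zeta>))\<^sup>2)\<^sup>2"
    using nz' by (simp_all add: \<alpha>_def \<beta>_def D_def norm_divide power_divide power2_eq_square)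
  have cross: "\<alpha> * cnj \<beta> * D = (cmod (1 + \<zeta>))\<^sup>2 * ((1 + cnj \<zeta> * p) * (1 + \<zeta> * q))"
  proof -
    have "complex_of_real D = (1 + \<zeta> * p) * cnj (1 + \<zeta> * p) * ((1 + \<zeta> * q) * cnj (1 + \<zeta> * q))"
      unfolding D_def of_real_mult complex_norm_square ..
    then have "\<alpha> * cnj \<beta> * D = (\<alpha> * (1 + \<zeta> * p)) * cnj (\<beta> * (1 + \<zeta> * q)) *
        (cnj (1 + \<zeta> * p) * (1 + \<zeta> * q))"
      by (simp only: complex_cnj_mult mult_ac)
    also have "\<dots> = (1 + \<zeta>) * cnj (1 + \<zeta>) * (cnj (1 + \<zeta> * p) * (1 + \<zeta> * q))"
      using nz' by (simp add: \<alpha>_def \<beta>_def)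
    finally show ?thesis by (simp only: complex_norm_square) simp
  qed
  have "((norm (a - b))\<^sup>2 - ((norm a)\<^sup>2 * (norm b)\<^sup>2 - (cmod (cinner a b))\<^sup>2)) * D =
      (cmod \<alpha>)\<^sup>2 * D * p + (cmod \<beta>)\<^sup>2 * D * q - 2 * Re (\<alpha> * cnj \<beta> * D * c)
        - (cmod \<alpha>)\<^sup>2 * (cmod \<beta>)\<^sup>2 * D * G"
  proof -
    have "(norm (a - b))\<^sup>2 = (cmod \<alpha>)\<^sup>2 * p + (cmod \<beta>)\<^sup>2 * q - 2 * Re (\<alpha> * cnj \<beta> * c)"
      unfolding norm_diff_sq ab
      by (simp add: norm_scaleC power_mult_distrib p_def q_def c_def cinner_scaleC_left
          cinner_scaleC_right algebra_simps)
    moreover have "(norm a)\<^sup>2 * (norm b)\<^sup>2 - (cmod (cinner a b))\<^sup>2 = (cmod \<alpha>)\<^sup>2 * (cmod \<beta>)\<^sup>2 * G"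
      unfolding ab by (simp add: norm_scaleC power_mult_distrib p_def q_def c_def G_def norm_mult
          cinner_scaleC_left cinner_scaleC_right algebra_simps)
    moreover have "Re (\<alpha> * cnj \<beta> * D * c) = Re (\<alpha> * cnj \<beta> * c) * D"
    proof -
      have "Re (complex_of_real k * z) = Re z * k" for k z by simp
      moreover have "\<alpha> * cnj \<beta> * D * c = complex_of_real D * (\<alpha> * cnj \<beta> * c)"
        by (simp only: mult_ac)
      ultimately show ?thesis by (simp only:)
    qed
    ultimately show ?thesis by (simp only:) (simp add: algebra_simps)
  qed
  also have "\<dots> = (cmod (1 + \<zeta>))\<^sup>2 *
      (e\<^sup>2 * (1 + (cmod \<zeta>)\<^sup>2 * (p * q)) - (cmod \<zeta>)\<^sup>2 * (1 - p * q) * G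
        + 2 * Re (cnj \<zeta> * ((p - cnj c) * (q - c))))"
  proof -
    have br: "(cmod (1 + \<zeta> * q))\<^sup>2 * p + (cmod (1 + \<zeta> * p))\<^sup>2 * q
          - 2 * Re ((1 + cnj \<zeta> * p) * (1 + \<zeta> * q) * c) - (cmod (1 + \<zeta>))\<^sup>2 * G =
        e\<^sup>2 * (1 + (cmod \<zeta>)\<^sup>2 * (p * q)) - (cmod \<zeta>)\<^sup>2 * (1 - p * q) * G
          + 2 * Re (cnj \<zeta> * ((p - cnj c) * (q - c)))"
      unfolding e2 G_def cmod_power2 by (simp add: power2_eq_square algebra_simps)
    have R: "Re (\<alpha> * cnj \<beta> * D * c) =
        (cmod (1 + \<zeta>))\<^sup>2 * Re ((1 + cnj \<zeta> * p) * (1 + \<zeta> * q) * c)"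
    proof -
      have "Re (complex_of_real k * z) = k * Re z" for k z by simp
      moreover have "\<alpha> * cnj \<beta> * D * c = complex_of_real ((cmod (1 + \<zeta>))\<^sup>2) *
          ((1 + cnj \<zeta> * p) * (1 + \<zeta> * q) * c)"
        unfolding cross by (simp only: mult.assoc)
      ultimately show ?thesis by (simp only:)
    qed
    show ?thesis
      unfolding \<alpha> \<beta> \<alpha>\<beta> R br[symmetric] by (simp only: algebra_simps power2_eq_square)
  qed
  also have "\<dots> \<le> (cmod (1 + \<zeta>))\<^sup>2 * ((1 + r) * e)\<^sup>2"
  proof (rule mult_left_mono)
    have "Re (cnj \<zeta> * ((p - cnj c) * (q - c))) \<le> cmod \<zeta> * (cmod (p - cnj c) * cmod (q - c))"
      by (metis complex_Re_le_cmod complex_mod_cnj norm_mult)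
    also have "cmod (p - cnj c) = cmod (p - c)"
      by (metis complex_cnj_diff complex_mod_cnj complex_cnj_complex_of_real)
    also have "cmod \<zeta> * (cmod (p - c) * cmod (q - c)) \<le> r * (e * e)"
      using r ep eq r0 e0 by (intro mult_mono) auto
    finally have "Re (cnj \<zeta> * ((p - cnj c) * (q - c))) \<le> r * e\<^sup>2" by (simp add: power2_eq_square)
    moreover have "(cmod \<zeta>)\<^sup>2 * (p * q) \<le> r\<^sup>2 * (1 * 1)"
      using r r0 pq by (intro mult_mono power_mono) auto
    then have "e\<^sup>2 * (1 + (cmod \<zeta>)\<^sup>2 * (p * q)) \<le> e\<^sup>2 * (1 + r\<^sup>2)"
      by (intro mult_left_mono) auto
    moreover have "p * q \<le> 1" using pq by (simp add: mult_le_one)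
    then have "0 \<le> (cmod \<zeta>)\<^sup>2 * (1 - p * q) * G" using G by simp
    ultimately show "e\<^sup>2 * (1 + (cmod \<zeta>)\<^sup>2 * (p * q)) - (cmod \<zeta>)\<^sup>2 * (1 - p * q) * G
        + 2 * Re (cnj \<zeta> * ((p - cnj c) * (q - c))) \<le> ((1 + r) * e)\<^sup>2"
      by (simp add: power2_eq_square algebra_simps)
  qed simp
  finally show ?thesis
    using D unfolding p_def[symmetric] q_def[symmetric] D_def
    by (simp add: power_divide power_mult_distrib pos_le_divide_eq mult_ac)
qed

lemma radial_disc_field_derivative:
  fixes \<zeta> :: complex
  assumes hol: "holomorphic_on_ball f"
    and nz: "1 + \<zeta> * (norm x)\<^sup>2 \<noteq> 0" and b: "radial_disc x \<zeta> \<in> ball 0 1"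
  shows "((\<lambda>\<zeta>. f (radial_disc x \<zeta>)) has_field_derivative
    grad f (radial_disc x \<zeta>) (((1 - (norm x)\<^sup>2) / (1 + \<zeta> * (norm x)\<^sup>2)\<^sup>2) *\<^sub>C x)) (at \<zeta>)"
proof (rule has_field_derivative_along_disc[where \<gamma> = "radial_disc x", OF hol b])
  have "((\<lambda>\<zeta>. (1 + \<zeta>) / (1 + \<zeta> * (norm x)\<^sup>2)) has_field_derivative
      ((1 - (norm x)\<^sup>2) / (1 + \<zeta> * (norm x)\<^sup>2)\<^sup>2)) (at \<zeta>)"
    using nz by (auto intro!: derivative_eq_intros simp: power2_eq_square algebra_simps)
  from has_derivative_scaleC_const[OF this, of x]
  show "(radial_disc x has_derivative
      (\<lambda>h. h *\<^sub>C ((1 - (norm x)\<^sup>2) / (1 + \<zeta> * (norm x)\<^sup>2)\<^sup>2) *\<^sub>C x)) (at \<zeta>)"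
    by (simp add: radial_disc_def[abs_def])
qed

lemma radial_disc_zero: "radial_disc x 0 = x"
  by (simp add: radial_disc_def scaleC_one)

lemma weighted_radial_deriv_le:
  fixes x :: "'a::complex_hilbert"
  assumes f: "f \<in> bloch_space" and x: "x \<in> ball 0 1"
  shows "(1 - (norm x)\<^sup>2) * cmod (radial_deriv f x) \<le> inv_seminorm f"
proof -
  note pos = one_minus_norm_sq_pos[OF x]
  have "cmod (radial_deriv f x) \<le> inv_seminorm f *
      (sqrt ((norm x)\<^sup>2 * (1 - (norm x)\<^sup>2) + (cmod (cinner x x))\<^sup>2) / (1 - (norm x)\<^sup>2))"
    unfolding radial_deriv_def by (rule bloch_grad_le_seminorm[OF f x])
  also have "(norm x)\<^sup>2 * (1 - (norm x)\<^sup>2) + (cmod (cinner x x))\<^sup>2 = (norm x)\<^sup>2"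
    by (simp add: cinner_self norm_power norm_mult algebra_simps power2_eq_square)
  finally have "(1 - (norm x)\<^sup>2) * cmod (radial_deriv f x) \<le> inv_seminorm f * norm x"
    using pos by (simp add: field_simps)
  also have "\<dots> \<le> inv_seminorm f * 1"
    using x by (intro mult_left_mono inv_seminorm_nonneg f) auto
  finally show ?thesis by simp
qed

text \<open>Cauchy's estimate for \<open>\<zeta> \<mapsto> f (radial_disc x \<zeta>) - f (radial_disc y \<zeta>)\<close> on the circle of radius
  \<open>1/5\<close>, whose values are bounded by the two-point estimate. Since \<open>\<rho> \<le> 1/14\<close>, the factor
  \<open>1 / (1 - \<rho>)\<close> coming from \<open>pseudohyp_dist_bounds\<close> is at most \<open>14/13\<close>.\<close>

lemma weighted_radial_deriv_diff_le:
  fixes x y :: "'a::complex_hilbert"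
  assumes f: "f \<in> bloch_space" and x: "x \<in> ball 0 1" and y: "y \<in> ball 0 1"
    and \<rho>: "pseudohyp_dist x y \<le> 1 / 14"
  shows "cmod ((1 - (norm x)\<^sup>2) * radial_deriv f x - (1 - (norm y)\<^sup>2) * radial_deriv f y)
    \<le> 14 * inv_seminorm f * pseudohyp_dist x y"
proof -
  have hol: "holomorphic_on_ball f" using f by (simp add: bloch_space_def)
  define \<rho> where "\<rho> = pseudohyp_dist x y"
  define e where "e = \<rho> * cmod (1 - cinner x y)"
  \<comment> \<open>\<open>63/26\<close> is \<open>14/13 * (6/5)^2 * (3/2) / (24/25)\<close>: the powers of \<open>1 + r = 6/5\<close> come from the expansion
    factor and \<open>|1 + \<zeta>|\<close>, \<open>3/2\<close> bounds the ratio of the two denominators, and \<open>24/25\<close> is \<open>1 - r^2\<close>.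
    Then \<open>5 * 63/26 < 14\<close>.\<close>
  define K where "K = 63 / 26 * \<rho>"
  have \<rho>0: "0 \<le> \<rho>" "\<rho> \<le> 1 / 14" using pseudohyp_dist_sq(1)[OF x y] \<rho> by (simp_all add: \<rho>_def)
  have e0: "0 \<le> e" using \<rho>0 by (simp add: e_def)
  have gap: "13 / 14 * e \<le> \<rho> * (1 - (norm z)\<^sup>2)" if "z = x \<or> z = y" for z
  proof -
    have "cmod (1 - cinner y x) = cmod (1 - cinner x y)"
      unfolding cinner_commute[of y x] by (metis complex_cnj_diff complex_cnj_one complex_mod_cnj)
    then have "(1 - \<rho>) * e \<le> \<rho> * (1 - (norm z)\<^sup>2)"
      using that pseudohyp_dist_bounds(2)[OF x y] pseudohyp_dist_bounds(2)[OF y x]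
        pseudohyp_dist_commute[of x y] by (auto simp: \<rho>_def e_def)
    moreover have "13 / 14 * e \<le> (1 - \<rho>) * e"
      using \<rho>0 e0 by (intro mult_right_mono) auto
    ultimately show ?thesis by linarith
  qed
  have p: "0 \<le> (norm z)\<^sup>2" "(norm z)\<^sup>2 \<le> 1" if "z \<in> ball 0 1" for z :: 'a
    using one_minus_norm_sq_pos[OF that] by auto
  have nz: "1 + \<zeta> * (norm z)\<^sup>2 \<noteq> 0" if "cmod \<zeta> \<le> 1 / 5" "z \<in> ball 0 1" for \<zeta> and z :: 'a
    using radial_disc_denom_bounds(1)[OF that(1) p[OF that(2)]] by auto
  have inball: "radial_disc z \<zeta> \<in> ball 0 1"
    and gap': "24 / 25 * (1 - (norm z)\<^sup>2) / (cmod (1 + \<zeta> * (norm z)\<^sup>2))\<^sup>2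
      \<le> 1 - (norm (radial_disc z \<zeta>))\<^sup>2"
    if \<zeta>: "cmod \<zeta> \<le> 1 / 5" and z: "z \<in> ball 0 1" for \<zeta> and z :: 'a
  proof -
    have "(cmod \<zeta>)\<^sup>2 * (norm z)\<^sup>2 \<le> (1 / 5)\<^sup>2 * 1"
      using \<zeta> p[OF z] by (intro mult_mono power_mono) auto
    then have "24 / 25 * (1 - (norm z)\<^sup>2) \<le> (1 - (norm z)\<^sup>2) * (1 - (cmod \<zeta>)\<^sup>2 * (norm z)\<^sup>2)"
      using one_minus_norm_sq_pos[OF z]
      by (subst mult.commute) (intro mult_left_mono, auto simp: power2_eq_square)
    then show gap': "24 / 25 * (1 - (norm z)\<^sup>2) / (cmod (1 + \<zeta> * (norm z)\<^sup>2))\<^sup>2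
        \<le> 1 - (norm (radial_disc z \<zeta>))\<^sup>2"
      unfolding one_minus_norm_radial_disc[OF nz[OF \<zeta> z]] by (rule divide_right_mono) simp
    have "0 < 24 / 25 * (1 - (norm z)\<^sup>2) / (cmod (1 + \<zeta> * (norm z)\<^sup>2))\<^sup>2"
      using one_minus_norm_sq_pos[OF z] nz[OF \<zeta> z] by (intro divide_pos_pos) auto
    with gap' have "(norm (radial_disc z \<zeta>))\<^sup>2 < 1" by linarith
    then show "radial_disc z \<zeta> \<in> ball 0 1" by (simp add: abs_square_less_1)
  qed
  have est: "cmod (1 + \<zeta>) * (1 + 1 / 5) * e / (cmod (1 + \<zeta> * (norm z)\<^sup>2) * cmod (1 + \<zeta> * (norm z')\<^sup>2))
      \<le> K * (1 - (norm (radial_disc z \<zeta>))\<^sup>2)"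
    if \<zeta>: "cmod \<zeta> \<le> 1 / 5" and z: "z \<in> ball 0 1" "z = x \<or> z = y" and z': "z' \<in> ball 0 1"
    for \<zeta> and z z' :: 'a
  proof -
    define m n where "m = cmod (1 + \<zeta> * (norm z)\<^sup>2)" and "n = cmod (1 + \<zeta> * (norm z')\<^sup>2)"
    have m: "0 < m" "m \<le> 6 / 5"
      using radial_disc_denom_bounds[OF \<zeta> p[OF z(1)]] by (auto simp: m_def)
    have n: "4 / 5 \<le> n"
      using radial_disc_denom_bounds[OF \<zeta> p[OF z']] by (auto simp: n_def)
    have l: "cmod (1 + \<zeta>) \<le> 6 / 5"
      using radial_disc_denom_bounds(2)[OF \<zeta>, of 1] by simp
    have "cmod (1 + \<zeta>) * (1 + 1 / 5) * e / (m * n) = cmod (1 + \<zeta>) * m * (6 / 5 * e) / (m\<^sup>2 * n)"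
      using m(1) by (simp add: power2_eq_square)
    also have "\<dots> \<le> (6 / 5) * (6 / 5) * (6 / 5 * e) / (m\<^sup>2 * (4 / 5))"
      using m n l e0 by (intro frac_le mult_mono mult_pos_pos mult_nonneg_nonneg) auto
    also have "\<dots> = (14 / 13 * (54 / 25)) * (13 / 14 * e) / m\<^sup>2" by simp
    also have "\<dots> \<le> (14 / 13 * (54 / 25)) * (\<rho> * (1 - (norm z)\<^sup>2)) / m\<^sup>2"
      using gap[OF z(2)] by (intro divide_right_mono mult_left_mono) auto
    also have "\<dots> = K * (24 / 25 * (1 - (norm z)\<^sup>2) / m\<^sup>2)"
      using m(1) by (simp add: K_def field_simps)
    also have "\<dots> \<le> K * (1 - (norm (radial_disc z \<zeta>))\<^sup>2)"
      using gap'[OF \<zeta> z(1)] \<rho>0 by (intro mult_left_mono) (auto simp: K_def m_def)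
    finally show ?thesis by (simp add: m_def n_def)
  qed
  define H' where "H' \<zeta> =
    grad f (radial_disc x \<zeta>) (((1 - (norm x)\<^sup>2) / (1 + \<zeta> * (norm x)\<^sup>2)\<^sup>2) *\<^sub>C x) -
    grad f (radial_disc y \<zeta>) (((1 - (norm y)\<^sup>2) / (1 + \<zeta> * (norm y)\<^sup>2)\<^sup>2) *\<^sub>C y)" for \<zeta> :: complex
  have "cmod (H' 0) \<le> (inv_seminorm f * K) / (1 / 5)"
  proof (rule Cauchy_estimate_deriv[where H = "\<lambda>\<zeta>. f (radial_disc x \<zeta>) - f (radial_disc y \<zeta>)"])
    show "((\<lambda>\<zeta>. f (radial_disc x \<zeta>) - f (radial_disc y \<zeta>)) has_field_derivative H' \<zeta>) (at \<zeta>)"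
      if "cmod \<zeta> \<le> 1 / 5" for \<zeta>
      unfolding H'_def
      by (intro DERIV_diff radial_disc_field_derivative hol nz inball that x y)
    fix \<zeta> :: complex assume "cmod \<zeta> = 1 / 5"
    then have \<zeta>: "cmod \<zeta> \<le> 1 / 5" by simp
    show "cmod (f (radial_disc x \<zeta>) - f (radial_disc y \<zeta>)) \<le> inv_seminorm f * K"
    proof (rule bloch_two_point_estimate[OF f inball[OF \<zeta> x] inball[OF \<zeta> y]])
      show "(norm (radial_disc x \<zeta> - radial_disc y \<zeta>))\<^sup>2 - ((norm (radial_disc x \<zeta>))\<^sup>2 *
          (norm (radial_disc y \<zeta>))\<^sup>2 - (cmod (cinner (radial_disc x \<zeta>) (radial_disc y \<zeta>)))\<^sup>2)
        \<le> (cmod (1 + \<zeta>) * (1 + 1 / 5) * e /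
            (cmod (1 + \<zeta> * (norm x)\<^sup>2) * cmod (1 + \<zeta> * (norm y)\<^sup>2)))\<^sup>2"
        using radial_disc_expansion[OF x y \<zeta> nz[OF \<zeta> x] nz[OF \<zeta> y]] by (simp only: e_def \<rho>_def)
      show "cmod (1 + \<zeta>) * (1 + 1 / 5) * e / (cmod (1 + \<zeta> * (norm x)\<^sup>2) * cmod (1 + \<zeta> * (norm y)\<^sup>2))
          \<le> K * (1 - (norm (radial_disc y \<zeta>))\<^sup>2)"
        using est[OF \<zeta> y _ x] by (simp add: mult.commute)
    qed (use e0 est[OF \<zeta> x _ y] in auto)
  qed simp
  moreover have "H' 0 = (1 - (norm x)\<^sup>2) * radial_deriv f x - (1 - (norm y)\<^sup>2) * radial_deriv f y"
    unfolding H'_def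
    using holomorphic_on_ball_grad(2)[OF hol x] holomorphic_on_ball_grad(2)[OF hol y]
    by (simp add: radial_disc_zero radial_deriv_def)
  moreover have "(inv_seminorm f * K) / (1 / 5) \<le> 14 * inv_seminorm f * \<rho>"
    using inv_seminorm_nonneg[OF f] \<rho>0 by (simp add: K_def mult_left_mono)
  ultimately show ?thesis by (simp add: \<rho>_def)
qed

theorem corollary3p5:
  fixes f :: "'a::complex_hilbert \<Rightarrow> complex"
  assumes "f \<in> bloch_space"
  shows "pseudohyp_lipschitz (\<lambda>x. (1 - (norm x)\<^sup>2) * cmod (radial_deriv f x)) \<and>
    (\<forall>x\<in>ball 0 1. \<forall>y\<in>ball 0 1.
      \<bar>(1 - (norm x)\<^sup>2) * cmod (radial_deriv f x) - (1 - (norm y)\<^sup>2) * cmod (radial_deriv f y)\<bar>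
        \<le> 14 * inv_seminorm f * pseudohyp_dist x y)"
proof -
  have M: "0 \<le> inv_seminorm f" by (rule inv_seminorm_nonneg[OF assms])
  have main: "\<bar>(1 - (norm x)\<^sup>2) * cmod (radial_deriv f x) - (1 - (norm y)\<^sup>2) * cmod (radial_deriv f y)\<bar>
      \<le> 14 * inv_seminorm f * pseudohyp_dist x y"
    if x: "x \<in> ball 0 1" and y: "y \<in> ball 0 1" for x y
  proof (cases "pseudohyp_dist x y \<le> 1 / 14")
    case True
    have "(1 - (norm z)\<^sup>2) * cmod (radial_deriv f z) =
        cmod (complex_of_real (1 - (norm z)\<^sup>2) * radial_deriv f z)"
      if "z \<in> ball 0 1" for z
      using one_minus_norm_sq_pos[OF that] by (simp only: norm_mult norm_of_real)
    then show ?thesis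
      using weighted_radial_deriv_diff_le[OF assms x y True] x y
      by (auto intro: order.trans[OF norm_triangle_ineq3])
  next
    case False
    have nonneg: "0 \<le> (1 - (norm z)\<^sup>2) * cmod (radial_deriv f z)" if "z \<in> ball 0 1" for z
      using one_minus_norm_sq_pos[OF that] by simp
    have "\<bar>(1 - (norm x)\<^sup>2) * cmod (radial_deriv f x) - (1 - (norm y)\<^sup>2) * cmod (radial_deriv f y)\<bar>
        \<le> inv_seminorm f * 1"
      using weighted_radial_deriv_le[OF assms x] weighted_radial_deriv_le[OF assms y]
        nonneg[OF x] nonneg[OF y] by linarith
    also have "\<dots> \<le> inv_seminorm f * (14 * pseudohyp_dist x y)"
      using False M by (intro mult_left_mono) auto
    finally show ?thesis by (simp add: mult_ac)
  qed
  moreover have "0 \<le> 14 * inv_seminorm f" using M by simp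
  ultimately show ?thesis unfolding pseudohyp_lipschitz_def by blast
qed

end
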